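(* If $\varphi:\mathbb{C}^+\to\mathbb{C}^+$ is a univalent self-mapping of $\mathbb{C}^+$, then the composition operator $C_\varphi f=f\circ\varphi$ maps $\mathfrak{D}(\mathbb{C}^+)$ into $\mathfrak{D}(\mathbb{C}^+)$ and is bounded on $\mathfrak{D}(\mathbb{C}^+)$.
   Context: $\mathbb{C}^+=\{z\in\mathbb{C}:\operatorname{Im} z>0\}$ is the upper half-plane and $dA$ is Lebesgue area measure. Univalent means analytic and injective. The Dirichlet space $\mathfrak{D}(\mathbb{C}^+)$ consists of all analytic functions $f$ on $\mathbb{C}^+$ with $\int_{\mathbb{C}^+}|f'(z)|^2\,dA(z)<\infty$, with norm given by $\|f\|^2_{\mathfrak{D}(\mathbb{C}^+)}=|f(i)|^2+\int_{\mathbb{C}^+}|f'(z)|^2\,dA(z)$; it is a Hilbert space. *)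

theory Defs
  imports "HOL-Complex_Analysis.Complex_Analysis"
begin

definition upper_half_plane :: "complex set" where
  "upper_half_plane = {z. Im z > 0}"

definition univalent_on :: "(complex \<Rightarrow> complex) \<Rightarrow> complex set \<Rightarrow> bool" where
  "univalent_on f S \<longleftrightarrow> f analytic_on S \<and> inj_on f S"

(* Functions on the upper half-plane are represented by total functions on the complex plane.
   Only their values on the (open) half-plane enter the definitions of the space and of its
   norm, so the values outside it are irrelevant. *)

definition dirichlet_space :: "(complex \<Rightarrow> complex) set" where
  "dirichlet_space = {f. f analytic_on upper_half_plane \<and>
     set_integrable lborel upper_half_plane (\<lambda>z. (cmod (deriv f z))\<^sup>2)}"

definition dirichlet_norm :: "(complex \<Rightarrow> complex) \<Rightarrow> real" where
  "dirichlet_norm f = sqrt ((cmod (f \<i>))\<^sup>2 +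
     (LINT z:upper_half_plane|lborel. (cmod (deriv f z))\<^sup>2))"

definition composition_operator ::
    "(complex \<Rightarrow> complex) \<Rightarrow> (complex \<Rightarrow> complex) \<Rightarrow> (complex \<Rightarrow> complex)" where
  "composition_operator \<phi> f = f \<circ> \<phi>"

(* A bounded complex-linear operator from the Dirichlet space into itself.  Identities between
   functions are required on the half-plane only, in line with the representation above. *)
definition bounded_operator_on_dirichlet_space ::
    "((complex \<Rightarrow> complex) \<Rightarrow> (complex \<Rightarrow> complex)) \<Rightarrow> bool" where
  "bounded_operator_on_dirichlet_space T \<longleftrightarrow>
     T ` dirichlet_space \<subseteq> dirichlet_space \<and>
     (\<forall>f\<in>dirichlet_space. \<forall>g\<in>dirichlet_space. \<forall>z\<in>upper_half_plane.
        T (\<lambda>w. f w + g w) z = T f z + T g z) \<and>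
     (\<forall>c. \<forall>f\<in>dirichlet_space. \<forall>z\<in>upper_half_plane. T (\<lambda>w. c * f w) z = c * T f z) \<and>
     (\<exists>K. \<forall>f\<in>dirichlet_space. dirichlet_norm (T f) \<le> K * dirichlet_norm f)"

end

theory Submission
  imports Defs
begin

text \<open>
  Two estimates make the composition operator bounded, one for each term of the norm.

  For the Dirichlet integral, the real Jacobian determinant of a holomorphic map \<open>\<phi>\<close> is
  \<open>\<bar>\<phi>'\<bar>\<^sup>2\<close>, which is exactly the factor that the chain rule puts into \<open>\<bar>(f \<circ> \<phi>)'\<bar>\<^sup>2\<close>. If \<open>\<phi>\<close> is
  injective, the integral of \<open>\<bar>(f \<circ> \<phi>)'\<bar>\<^sup>2\<close> is therefore the integral of \<open>\<bar>f'\<bar>\<^sup>2\<close> over the image of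
  \<open>\<phi>\<close>, and this image lies in the half-plane. So composition with \<open>\<phi>\<close> does not increase the
  Dirichlet integral (\<open>conformal_change_of_variables\<close>, \<open>dirichlet_integral_compose\<close>).

  The remaining term is \<open>\<bar>f (\<phi> \<i>)\<bar>\<close>, so it suffices that evaluation at any point \<open>w\<close> of the
  half-plane is bounded (\<open>dirichlet_point_evaluation_bounded\<close>). The discs of a suitable fixed
  radius around the points of the segment from \<open>\<i>\<close> to \<open>w\<close> all stay in the half-plane; by
  the area mean value inequality for \<open>(f')\<^sup>2\<close> on these discs (\<open>area_mean_value_le\<close>), the Dirichlet
  integral controls \<open>f'\<close> uniformly on the segment, and integrating along the segment
  controls \<open>f w - f \<i>\<close>. The area inequality comes from the mean value property on circles by
  polar coordinates. These are the conformal map \<open>\<zeta> \<mapsto> a + exp \<zeta>\<close>, so the same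
  change of variables applies.
\<close>

(* Otherwise vector components would be ambiguous with power series coefficients. *)
unbundle no Formal_Power_Series.fps_syntax

section \<open>Change of variables under conformal maps\<close>

text \<open>The general change of variables theorem lives on \<^typ>\<open>real^2\<close>; this carries Lebesgue measure over
  to the complex plane.\<close>
lemma lborel_complex_eq_distr_vec:
  "lborel = distr (lborel :: (real^2) measure) borel (\<lambda>v. Complex (v$1) (v$2))"
proof (rule lborel_eqI)
  fix l u :: complex
  assume "\<And>b. b \<in> Basis \<Longrightarrow> l \<bullet> b \<le> u \<bullet> b"
  from this[of 1] this[of \<i>] have le: "Re l \<le> Re u" "Im l \<le> Im u"
    by (auto simp: Basis_complex_def inner_complex_def)
  have meas: "(\<lambda>v::real^2. Complex (v$1) (v$2)) \<in> measurable lborel borel"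
    by (simp add: Complex_eq)
  have pre: "(\<lambda>v::real^2. Complex (v$1) (v$2)) -` box l u = box (vector [Re l, Im l]) (vector [Re u, Im u])"
    by (auto simp: in_box_complex_iff mem_box_cart forall_2)
  have B: "Basis = (\<lambda>i. axis i 1 :: real^2) ` UNIV" by (auto simp: Basis_vec_def)
  show "emeasure (distr (lborel :: (real^2) measure) borel (\<lambda>v. Complex (v$1) (v$2))) (box l u)
      = ennreal (\<Prod>b\<in>Basis. (u - l) \<bullet> b)"
    using le
    by (subst emeasure_distr[OF meas])
      (simp_all add: pre emeasure_lborel_box_eq B prod.reindex inj_on_def axis_eq_axis
        inner_axis UNIV_2 Basis_complex_def inner_complex_def)
qed simp

text \<open>Multiplication by \<open>c\<close> has the real matrix with rows \<open>(Re c, -Im c)\<close> and \<open>(Im c, Re c)\<close>.\<close>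
lemma det_matrix_complex_mult:
  fixes c :: complex
  shows "det (matrix (\<lambda>v::real^2. vector [Re (c * Complex (v$1) (v$2)), Im (c * Complex (v$1) (v$2))] :: real^2))
     = (cmod c)\<^sup>2"
  by (simp add: matrix_def det_2 axis_def cmod_power2 flip: power2_eq_square)

text \<open>By the Cauchy--Riemann equations the derivative of \<open>\<phi>\<close> at \<open>z\<close>, as a real linear map, is multiplication
  by \<open>\<phi>' z\<close>, so the Jacobian determinant is \<open>\<bar>\<phi>' z\<bar>\<^sup>2\<close>. Besides that, the proof only conjugates \<open>\<phi>\<close> with
  the isometry between \<^typ>\<open>real^2\<close> and \<^typ>\<open>complex\<close>.\<close>
lemma conformal_change_of_variables:
  fixes \<phi> :: "complex \<Rightarrow> complex" and u :: "complex \<Rightarrow> real"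
  assumes S: "open S" and hol: "\<phi> holomorphic_on S" and inj: "inj_on \<phi> S"
    and u: "set_integrable lborel (\<phi> ` S) u"
  shows "set_integrable lborel S (\<lambda>z. (cmod (deriv \<phi> z))\<^sup>2 * u (\<phi> z))"
    and "(LINT z:S|lborel. (cmod (deriv \<phi> z))\<^sup>2 * u (\<phi> z)) = (LINT w:\<phi> ` S|lborel. u w)"
proof -
  define V :: "real^2 \<Rightarrow> complex" where "V = (\<lambda>v. Complex (v$1) (v$2))"
  define W :: "complex \<Rightarrow> real^2" where "W = (\<lambda>z. vector [Re z, Im z])"
  have VW [simp]: "V (W z) = z" for z by (simp add: V_def W_def)
  have WV [simp]: "W (V x) = x" for x by (simp add: V_def W_def vec_eq_iff forall_2)
  have linV: "bounded_linear V"
    unfolding V_def linear_conv_bounded_linear[symmetric]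
    by (rule linearI) (auto simp: complex_eq_iff)
  have linW: "bounded_linear W"
    unfolding W_def linear_conv_bounded_linear[symmetric]
    by (rule linearI) (auto simp: vec_eq_iff forall_2)
  have Vmeas [measurable]: "V \<in> borel_measurable borel"
    by (intro borel_measurable_continuous_onI linear_continuous_on linV)
  have distr: "lborel = distr lborel borel V"
    unfolding V_def by (rule lborel_complex_eq_distr_vec)
  define T where "T = V -` S"
  have T: "open T" unfolding T_def
    by (intro open_vimage S linear_continuous_on linV)
  define g where "g = W \<circ> \<phi> \<circ> V"
  have gT: "g ` T = V -` (\<phi> ` S)"
  proof -
    have "y \<in> g ` T" if "V y = \<phi> z" "z \<in> S" for y z
      using that by (intro image_eqI[of _ _ "W z"]) (auto simp: g_def T_def simp flip: that(1))
    then show ?thesis by (auto simp: g_def T_def)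
  qed
  define g' where "g' = (\<lambda>x v. W (deriv \<phi> (V x) * V v))"
  have der: "(g has_derivative g' x) (at x within T)" if "x \<in> T" for x
  proof -
    have "(\<phi> has_field_derivative deriv \<phi> (V x)) (at (V x))"
      using that hol S by (auto simp: T_def intro: holomorphic_derivI)
    then have "(\<phi> has_derivative (*) (deriv \<phi> (V x))) (at (V x))"
      by (simp add: has_field_derivative_def)
    from has_derivative_compose[OF bounded_linear_imp_has_derivative[OF linV, of "at x"] this]
    have "((\<lambda>y. \<phi> (V y)) has_derivative (\<lambda>v. deriv \<phi> (V x) * V v)) (at x)" .
    from bounded_linear.has_derivative[OF linW this] show ?thesis
      unfolding g_def g'_def comp_def by (rule has_derivative_at_withinI)
  qed
  have detg: "det (matrix (g' x)) = (cmod (deriv \<phi> (V x)))\<^sup>2" for x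
    unfolding g'_def W_def V_def by (rule det_matrix_complex_mult)
  have injg: "inj_on g T"
    unfolding g_def T_def
    by (auto intro!: inj_onI) (metis VW WV inj inj_onD)
  have Vg: "V (g x) = \<phi> (V x)" for x by (simp add: g_def)
  have um [measurable]: "(\<lambda>w. indicator (\<phi> ` S) w *\<^sub>R u w) \<in> borel_measurable borel"
    using u by (auto simp: set_integrable_def)
  define F where "F = (\<lambda>w. indicator (\<phi> ` S) w *\<^sub>R u w)"
  define G where "G = (\<lambda>z. indicator S z *\<^sub>R ((cmod (deriv \<phi> z))\<^sup>2 * u (\<phi> z)))"
  have Fm: "F \<in> borel_measurable borel" unfolding F_def by (rule um)
  \<comment> \<open>\<open>\<phi>\<close> and its derivative are arbitrary outside \<open>S\<close>, so both are cut off before composing.\<close>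
  have Gm: "G \<in> borel_measurable borel"
  proof -
    have 1: "(\<lambda>z. indicator S z *\<^sub>R \<phi> z) \<in> borel_measurable borel"
      using S hol by (intro borel_measurable_continuous_on_indicator) (auto intro: holomorphic_on_imp_continuous_on)
    have 2: "(\<lambda>z. indicator S z *\<^sub>R deriv \<phi> z) \<in> borel_measurable borel"
      using S hol by (intro borel_measurable_continuous_on_indicator) (auto intro!: holomorphic_on_imp_continuous_on holomorphic_deriv)
    have "(\<lambda>z. (cmod (indicator S z *\<^sub>R deriv \<phi> z))\<^sup>2 * F (indicator S z *\<^sub>R \<phi> z)) \<in> borel_measurable borel"
      using measurable_compose[OF 1 Fm] 2 by measurable
    also have "(\<lambda>z. (cmod (indicator S z *\<^sub>R deriv \<phi> z))\<^sup>2 * F (indicator S z *\<^sub>R \<phi> z)) = G"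
      by (auto simp: fun_eq_iff G_def F_def indicator_def)
    finally show ?thesis .
  qed
  have FV: "F (V x) = indicator (g ` T) x *\<^sub>R u (V x)" for x
    by (simp add: F_def gT indicator_def)
  have GV: "G (V x) = indicator T x *\<^sub>R (\<bar>det (matrix (g' x))\<bar> *\<^sub>R u (V (g x)))" for x
    by (simp add: G_def detg Vg T_def indicator_def)
  have F1: "integrable lborel (\<lambda>x. F (V x))"
    using u Fm unfolding set_integrable_def F_def[symmetric]
    by (subst (asm) distr) (simp add: integrable_distr_eq)
  have "(\<lambda>x. u (V x)) absolutely_integrable_on (g ` T)"
    using F1 Fm unfolding FV set_integrable_def
    by (subst integrable_completion) (auto simp flip: FV)
  \<comment> \<open>The change of variables theorem is about vector-valued integrands, hence the detour
    through \<^typ>\<open>real^1\<close>.\<close>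
  then have absF: "(\<lambda>x. vec (u (V x)) :: real^1) absolutely_integrable_on (g ` T)"
    by (simp add: absolutely_integrable_on_1_iff)
  have "(\<lambda>x. \<bar>det (matrix (g' x))\<bar> *\<^sub>R (vec (u (V (g x))) :: real^1)) absolutely_integrable_on T
     \<and> integral T (\<lambda>x. \<bar>det (matrix (g' x))\<bar> *\<^sub>R (vec (u (V (g x))) :: real^1))
       = integral (g ` T) (\<lambda>x. vec (u (V x)))"
    using has_absolute_integral_change_of_variables[OF _ der injg, of "\<lambda>x. vec (u (V x)) :: real^1"
        "integral (g ` T) (\<lambda>x. vec (u (V x)))"] T absF by auto
  then have absG: "(\<lambda>x. \<bar>det (matrix (g' x))\<bar> *\<^sub>R u (V (g x))) absolutely_integrable_on T"
    and intG: "integral T (\<lambda>x. \<bar>det (matrix (g' x))\<bar> *\<^sub>R u (V (g x))) = integral (g ` T) (\<lambda>x. u (V x))"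
    by (simp_all add: absolutely_integrable_on_1_iff integral_on_1_eq)
  have G1: "integrable lborel (\<lambda>x. G (V x))"
    using absG Gm unfolding set_integrable_def GV[symmetric]
    by (subst (asm) integrable_completion) auto
  have "integrable (distr lborel borel V) G"
    using G1 Gm by (simp add: integrable_distr_eq)
  then show "set_integrable lborel S (\<lambda>z. (cmod (deriv \<phi> z))\<^sup>2 * u (\<phi> z))"
    by (simp add: set_integrable_def G_def distr[symmetric])
  have "integral\<^sup>L lborel G = integral\<^sup>L lborel (\<lambda>x. G (V x))"
    using Gm by (subst distr) (simp add: integral_distr)
  also have "\<dots> = integral T (\<lambda>x. \<bar>det (matrix (g' x))\<bar> *\<^sub>R u (V (g x)))"
    using set_lebesgue_integral_eq_integral(2)[OF absG] Gm
    unfolding set_lebesgue_integral_def GV[symmetric] by (simp add: integral_completion)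
  also have "\<dots> = integral (g ` T) (\<lambda>x. u (V x))" by (rule intG)
  also have "\<dots> = integral\<^sup>L lborel (\<lambda>x. F (V x))"
    using set_lebesgue_integral_eq_integral(2)[OF \<open>(\<lambda>x. u (V x)) absolutely_integrable_on (g ` T)\<close>] Fm
    unfolding set_lebesgue_integral_def FV[symmetric] by (simp add: integral_completion)
  also have "\<dots> = integral\<^sup>L lborel F"
    using Fm by (simp add: distr[symmetric] flip: integral_distr[of V lborel borel F])
  finally show "(LINT z:S|lborel. (cmod (deriv \<phi> z))\<^sup>2 * u (\<phi> z)) = (LINT w:\<phi> ` S|lborel. u w)"
    by (simp add: set_lebesgue_integral_def G_def F_def)
qed

section \<open>Area mean value inequality\<close>

lemma measurable_Complex: "(\<lambda>(x, y). Complex x y) \<in> borel_measurable lborel"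
  by (auto simp: Complex_eq split_beta intro!: borel_measurable_continuous_onI continuous_intros)

text \<open>This makes Tonelli's theorem available for integrals over the complex plane.\<close>
lemma lborel_complex_eq_distr_prod:
  "lborel = distr lborel borel (\<lambda>(x, y). Complex x y)"
proof (rule lborel_eqI)
  fix l u :: complex
  assume "\<And>b. b \<in> Basis \<Longrightarrow> l \<bullet> b \<le> u \<bullet> b"
  from this[of 1] this[of \<i>] have le: "Re l \<le> Re u" "Im l \<le> Im u"
    by (auto simp: Basis_complex_def inner_complex_def)
  have pre: "(\<lambda>(x, y). Complex x y) -` box l u = box (Re l, Im l) (Re u, Im u)"
    by (auto simp: in_box_complex_iff mem_box Basis_prod_def)
  show "emeasure (distr lborel borel (\<lambda>(x, y). Complex x y)) (box l u)
      = ennreal (\<Prod>b\<in>Basis. (u - l) \<bullet> b)"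
    using le
    by (subst emeasure_distr[OF measurable_Complex])
      (auto simp: pre emeasure_lborel_box_eq Basis_prod_def Basis_complex_def inner_complex_def
        prod.union_disjoint)
qed simp

text \<open>Cauchy's integral formula at the centre. The open interval matches the half-strip used below, and the
  extended nonnegative integral is what Tonelli's theorem produces on its fibres.\<close>
lemma circle_mean_value_le:
  fixes h :: "complex \<Rightarrow> complex"
  assumes hol: "h holomorphic_on cball a \<rho>" and \<rho>: "0 < \<rho>"
  shows "ennreal (2 * pi * cmod (h a))
    \<le> (\<integral>\<^sup>+ t. ennreal (cmod (h (a + \<rho> * cis t))) * indicator {0<..<2*pi} t \<partial>lborel)"
proof -
  define k where "k = (\<lambda>t. h (a + \<rho> * cis t))"
  have "((\<lambda>u. h u / (u - a)) has_contour_integral (2 * of_real pi * \<i> * h a)) (circlepath a \<rho>)"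
    using \<rho> by (intro Cauchy_integral_circlepath_simple hol) auto
  \<comment> \<open>On the circle the factor \<open>1 / (u - a)\<close> cancels against the velocity up to \<open>\<i>\<close>.\<close>
  then have "((\<lambda>t. h (a + \<rho> * cis t) / (a + \<rho> * cis t - a) * \<rho> * \<i> * cis t)
      has_integral (2 * of_real pi * \<i> * h a)) {0..2*pi}"
    by (simp add: circlepath_def has_contour_integral_part_circlepath_iff)
  then have I: "((\<lambda>t. \<i> * k t) has_integral (2 * of_real pi * \<i> * h a)) {0..2*pi}"
    by (rule has_integral_eq[rotated]) (use \<rho> in \<open>auto simp: k_def field_simps\<close>)
  have "continuous_on {0..2*pi} k"
    unfolding k_def
    by (rule continuous_on_compose2[OF holomorphic_on_imp_continuous_on[OF hol]])
      (use \<rho> in \<open>auto intro!: continuous_intros simp: dist_norm norm_mult\<close>)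
  then have int: "(\<lambda>t. cmod (k t)) integrable_on {0..2*pi}"
    by (intro integrable_continuous_real continuous_intros)
  have "cmod (integral {0..2*pi} (\<lambda>t. \<i> * k t)) \<le> integral {0..2*pi} (\<lambda>t. cmod (k t))"
    using I int by (intro integral_norm_bound_integral) (auto simp: norm_mult has_integral_integrable)
  then have "2 * pi * cmod (h a) \<le> integral {0..2*pi} (\<lambda>t. cmod (k t))"
    unfolding integral_unique[OF I] by (simp add: norm_mult)
  moreover have "(\<integral>\<^sup>+ t. ennreal (cmod (k t)) * indicator {0<..<2*pi} t \<partial>lborel)
      = ennreal (integral {0..2*pi} (\<lambda>t. cmod (k t)))"
    using int by (intro nn_integral_has_integral_lebesgue')
      (auto simp flip: has_integral_Icc_iff_Ioo)
  ultimately show ?thesis by (simp add: k_def ennreal_leI)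
qed

text \<open>The radial integral in the logarithmic radius \<open>x\<close>: the Jacobian factor of \<open>exp\<close> is \<open>(exp x)\<^sup>2\<close>.\<close>
lemma nn_integral_exp_lessThan:
  assumes r: "0 < r" and M: "0 \<le> M"
  shows "(\<integral>\<^sup>+ x. ennreal (2 * M * (exp x)\<^sup>2) * indicator {..<ln r} x \<partial>lborel) = ennreal (M * r\<^sup>2)"
proof -
  have e: "einterval (-\<infinity>) (ereal (ln r)) = {..<ln r}"
    by (auto simp: einterval_def)
  have lim: "((\<lambda>x. M * (exp x)\<^sup>2) \<longlongrightarrow> 0) at_bot"
    using tendsto_mult[OF tendsto_const tendsto_power[OF exp_at_bot, of 2], of M] by simp
  have lim2: "((\<lambda>x. M * (exp x)\<^sup>2) \<longlongrightarrow> M * r\<^sup>2) (at_left (ln r))"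
    by (rule tendsto_eq_intros refl | use r in simp)+
  have D: "DERIV (\<lambda>x. M * (exp x)\<^sup>2) x :> 2 * M * (exp x)\<^sup>2" for x
    by (auto intro!: derivative_eq_intros simp: power2_eq_square)
  have 1: "set_integrable lborel {..<ln r} (\<lambda>x. 2 * M * (exp x)\<^sup>2)"
    and 2: "(LBINT x=-\<infinity>..ln r. 2 * M * (exp x)\<^sup>2) = M * r\<^sup>2 - 0"
    using interval_integral_FTC_nonneg[of "-\<infinity>" "ereal (ln r)", OF _ D, of 0 "M * r\<^sup>2"] lim lim2 M
    by (auto simp: ereal_tendsto_simps1 e intro!: continuous_intros)
  have "(\<integral>\<^sup>+ x. ennreal (2 * M * (exp x)\<^sup>2) * indicator {..<ln r} x \<partial>lborel)
      = (\<integral>\<^sup>+ x. ennreal (indicator {..<ln r} x *\<^sub>R (2 * M * (exp x)\<^sup>2)) \<partial>lborel)"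
    by (intro nn_integral_cong) (auto simp: indicator_def)
  also have "\<dots> = ennreal (LBINT x:{..<ln r}. 2 * M * (exp x)\<^sup>2)"
    using 1 M unfolding set_lebesgue_integral_def set_integrable_def
    by (intro nn_integral_eq_integral) auto
  also have "(LBINT x:{..<ln r}. 2 * M * (exp x)\<^sup>2) = M * r\<^sup>2"
    using 2 unfolding interval_lebesgue_integral_def e by simp
  finally show ?thesis .
qed

lemma set_integral_mono_domain:
  fixes u :: "'a \<Rightarrow> real"
  assumes "set_integrable M B u" "A \<in> sets M" "A \<subseteq> B" "\<And>x. x \<in> B \<Longrightarrow> 0 \<le> u x"
  shows "(LINT x:A|M. u x) \<le> (LINT x:B|M. u x)"
  using set_integrable_subset[OF assms(1-3)] assms
  unfolding set_integrable_def set_lebesgue_integral_def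
  by (intro integral_mono) (auto split: split_indicator)

text \<open>In the coordinate \<open>\<zeta> = x + \<i> y\<close> with \<open>z = a + exp \<zeta>\<close>, the disc without a radius becomes a half-strip.
  On each vertical line the mean value property on the circle of radius \<open>exp x\<close> gives at least
  \<open>2 * pi * \<bar>h a\<bar> * (exp x)\<^sup>2\<close>, and Tonelli's theorem integrates this over \<open>x < ln r\<close>.\<close>
lemma area_mean_value_le:
  fixes h :: "complex \<Rightarrow> complex"
  assumes hol: "h holomorphic_on ball a r" and r: "0 < r"
    and int: "set_integrable lborel (ball a r) (\<lambda>z. cmod (h z))"
  shows "pi * r\<^sup>2 * cmod (h a) \<le> (LINT z:ball a r|lborel. cmod (h z))"
proof -
  define S where "S = {\<zeta>. Re \<zeta> < ln r \<and> 0 < Im \<zeta> \<and> Im \<zeta> < 2 * pi}"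
  define polar where "polar = (\<lambda>\<zeta>. a + exp \<zeta>)"
  have S: "open S" unfolding S_def
    by (intro open_Collect_conj open_Collect_less continuous_intros)
  have holpol: "polar holomorphic_on S" unfolding polar_def by (intro holomorphic_intros)
  have inj: "inj_on polar S"
    by (auto simp: inj_on_def polar_def S_def intro!: exp_complex_eqI)
  have sub: "polar ` S \<subseteq> ball a r"
  proof clarify
    fix \<zeta> assume "\<zeta> \<in> S"
    then have "exp (Re \<zeta>) < exp (ln r)" by (simp add: S_def)
    then show "polar \<zeta> \<in> ball a r" using r by (simp add: polar_def dist_norm)
  qed
  have op: "open (polar ` S)" by (rule open_mapping_thm3[OF holpol S inj])
  have int': "set_integrable lborel (polar ` S) (\<lambda>z. cmod (h z))"
    using set_integrable_subset[OF int _ sub] op by simp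
  have d: "deriv polar \<zeta> = exp \<zeta>" for \<zeta>
    unfolding polar_def by (rule DERIV_imp_deriv) (auto intro!: derivative_eq_intros)
  define G where "G = (\<lambda>\<zeta>. indicator S \<zeta> *\<^sub>R ((cmod (deriv polar \<zeta>))\<^sup>2 * cmod (h (polar \<zeta>))))"
  have G: "integrable lborel G" "integral\<^sup>L lborel G = (LINT z:polar ` S|lborel. cmod (h z))"
    using conformal_change_of_variables[OF S holpol inj int']
    by (simp_all add: G_def set_integrable_def set_lebesgue_integral_def)
  have Gm: "G \<in> borel_measurable borel" using G(1) by auto
  have p: "polar (Complex x y) = a + exp x * cis y" for x y
    by (simp add: polar_def exp_eq_polar)
  have fib: "ennreal (2 * (pi * cmod (h a)) * (exp x)\<^sup>2) * indicator {..<ln r} x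
      \<le> (\<integral>\<^sup>+ y. ennreal (G (Complex x y)) \<partial>lborel)" for x
  proof (cases "x < ln r")
    case True
    then have "exp x < exp (ln r)" by simp
    then have er: "exp x < r" using r by simp
    have "(\<lambda>z. of_real ((exp x)\<^sup>2) * h z) holomorphic_on cball a (exp x)"
      using er by (intro holomorphic_intros holomorphic_on_subset[OF hol]) auto
    \<comment> \<open>The Jacobian is constant on the circle, so it can be made part of the holomorphic function
      instead of being pulled out of the integral.\<close>
    from circle_mean_value_le[OF this] True
    have "ennreal (2 * (pi * cmod (h a)) * (exp x)\<^sup>2) * indicator {..<ln r} x
       \<le> (\<integral>\<^sup>+ t. ennreal ((exp x)\<^sup>2 * cmod (h (a + exp x * cis t))) * indicator {0<..<2*pi} t \<partial>lborel)"
      by (simp add: norm_mult norm_power mult_ac)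
    also have "\<dots> = (\<integral>\<^sup>+ y. ennreal (G (Complex x y)) \<partial>lborel)"
      using True by (intro nn_integral_cong) (auto simp: G_def S_def d p indicator_def exp_of_real)
    finally show ?thesis .
  qed simp
  have "ennreal (pi * r\<^sup>2 * cmod (h a)) = ennreal (pi * cmod (h a) * r\<^sup>2)" by (simp add: mult_ac)
  also have "\<dots> = (\<integral>\<^sup>+ x. ennreal (2 * (pi * cmod (h a)) * (exp x)\<^sup>2) * indicator {..<ln r} x \<partial>lborel)"
    by (rule nn_integral_exp_lessThan[symmetric]) (use r in auto)
  also have "\<dots> \<le> (\<integral>\<^sup>+ x. \<integral>\<^sup>+ y. ennreal (G (Complex x y)) \<partial>lborel \<partial>lborel)"
    by (intro nn_integral_mono fib)
  also have "\<dots> = (\<integral>\<^sup>+ p. ennreal (G (case p of (x, y) \<Rightarrow> Complex x y)) \<partial>lborel)"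
    using measurable_compose[OF measurable_Complex Gm] unfolding lborel_prod[symmetric]
    by (subst lborel.nn_integral_fst[symmetric]) auto
  also have "\<dots> = (\<integral>\<^sup>+ \<zeta>. ennreal (G \<zeta>) \<partial>lborel)"
    using Gm by (simp add: lborel_complex_eq_distr_prod nn_integral_distr[OF measurable_Complex])
  also have "\<dots> = ennreal (integral\<^sup>L lborel G)"
    by (intro nn_integral_eq_integral G) (auto simp: G_def)
  finally have "pi * r\<^sup>2 * cmod (h a) \<le> integral\<^sup>L lborel G"
    using Bochner_Integration.integral_nonneg[of lborel G]
    by (subst (asm) ennreal_le_iff) (simp_all add: G_def)
  also have "\<dots> \<le> (LINT z:ball a r|lborel. cmod (h z))"
    unfolding G(2) using op by (intro set_integral_mono_domain int sub) auto
  finally show ?thesis .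
qed

section \<open>The Dirichlet space of the half-plane\<close>

lemma open_upper_half_plane: "open upper_half_plane"
  unfolding upper_half_plane_def by (intro open_Collect_less continuous_intros)

text \<open>Discs of radius \<open>min 1 (Im w)\<close> around points of the segment from \<open>\<i>\<close> to \<open>w\<close> lie in the half-plane, because
  every point of the segment has at least this imaginary part. Since \<open>(f')\<^sup>2\<close> is holomorphic, the area mean
  value inequality bounds \<open>\<bar>f'\<bar>\<^sup>2\<close> on the segment by a multiple of the Dirichlet integral.\<close>
lemma dirichlet_point_evaluation_bounded:
  assumes w: "w \<in> upper_half_plane"
  shows "\<exists>K. \<forall>f\<in>dirichlet_space. cmod (f w) \<le> K * dirichlet_norm f"
proof -
  define m where "m = min 1 (Im w)"
  have m: "0 < m" using w by (simp add: m_def upper_half_plane_def)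
  have seg: "m \<le> Im z" if "z \<in> closed_segment \<i> w" for z
  proof -
    have "closed_segment \<i> w \<subseteq> {z. m \<le> Im z}"
      by (rule closed_segment_subset) (auto simp: m_def convex_halfspace_Im_ge)
    then show ?thesis using that by auto
  qed
  have ball: "ball z m \<subseteq> upper_half_plane" if "z \<in> closed_segment \<i> w" for z
  proof
    fix y assume "y \<in> ball z m"
    then have "\<bar>Im (z - y)\<bar> < m"
      unfolding mem_ball dist_norm by (rule le_less_trans[OF abs_Im_le_cmod])
    then show "y \<in> upper_half_plane" using seg[OF that] by (simp add: upper_half_plane_def)
  qed
  \<comment> \<open>The factor \<open>1 / (sqrt pi * m)\<close> comes from the area mean value inequality, the other is the length
    of the segment.\<close>
  define c where "c = cmod (w - \<i>) / (sqrt pi * m)"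
  show ?thesis
  proof (intro exI[of _ "1 + c"] ballI)
    fix f assume f: "f \<in> dirichlet_space"
    define D where "D = (LINT z:upper_half_plane|lborel. (cmod (deriv f z))\<^sup>2)"
    have hol: "f holomorphic_on upper_half_plane"
      and int: "set_integrable lborel upper_half_plane (\<lambda>z. (cmod (deriv f z))\<^sup>2)"
      using f by (auto simp: dirichlet_space_def intro: analytic_imp_holomorphic)
    have D0: "0 \<le> D"
      unfolding D_def set_lebesgue_integral_def by (intro integral_nonneg_AE) auto
    have bd: "cmod (deriv f z) \<le> sqrt D / (sqrt pi * m)" if z: "z \<in> closed_segment \<i> w" for z
    proof -
      have hol': "(\<lambda>z. (deriv f z)\<^sup>2) holomorphic_on ball z m"
        by (intro holomorphic_intros holomorphic_on_subset[OF hol] ball z) auto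
      have "pi * m\<^sup>2 * cmod ((deriv f z)\<^sup>2) \<le> (LINT z:ball z m|lborel. cmod ((deriv f z)\<^sup>2))"
        using set_integrable_subset[OF int _ ball[OF z]]
        by (intro area_mean_value_le hol' m) (auto simp: norm_power)
      also have "\<dots> \<le> D"
        unfolding D_def norm_power by (intro set_integral_mono_domain int ball z) auto
      finally have "(sqrt pi * m * cmod (deriv f z))\<^sup>2 \<le> D"
        by (simp add: norm_power power_mult_distrib)
      then have "sqrt pi * m * cmod (deriv f z) \<le> sqrt D"
        by (rule real_le_rsqrt)
      then show ?thesis using m by (simp add: field_simps)
    qed
    have "cmod (f w - f \<i>) \<le> (sqrt D / (sqrt pi * m)) * cmod (w - \<i>)"
    proof (rule field_differentiable_bound[OF _ _ bd])
      show "(f has_field_derivative deriv f z) (at z within closed_segment \<i> w)"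
        if "z \<in> closed_segment \<i> w" for z
        using ball[OF that] m
        by (intro has_field_derivative_at_within[OF holomorphic_derivI[OF hol open_upper_half_plane]]) auto
    qed auto
    then have "cmod (f w) \<le> cmod (f \<i>) + c * sqrt D"
      using norm_triangle_ineq2[of "f w" "f \<i>"] by (simp add: c_def mult.commute)
    also have "cmod (f \<i>) \<le> dirichlet_norm f"
      unfolding dirichlet_norm_def D_def[symmetric] using D0 by (intro real_le_rsqrt) auto
    also have "c * sqrt D \<le> c * dirichlet_norm f"
      unfolding dirichlet_norm_def D_def[symmetric] using m
      by (intro mult_left_mono) (auto simp: c_def)
    finally show "cmod (f w) \<le> (1 + c) * dirichlet_norm f" by (simp add: algebra_simps)
  qed
qed

text \<open>The Dirichlet integral of \<open>f \<circ> \<phi>\<close> is that of \<open>f\<close> over the image of \<open>\<phi>\<close> only. Injectivity is what prevents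
  parts of the half-plane from being counted several times.\<close>
lemma dirichlet_integral_compose:
  assumes \<phi>: "\<phi> holomorphic_on upper_half_plane" "inj_on \<phi> upper_half_plane"
      "\<phi> ` upper_half_plane \<subseteq> upper_half_plane"
    and f: "f \<in> dirichlet_space"
  shows "f \<circ> \<phi> \<in> dirichlet_space"
    and "(LINT z:upper_half_plane|lborel. (cmod (deriv (f \<circ> \<phi>) z))\<^sup>2)
      \<le> (LINT z:upper_half_plane|lborel. (cmod (deriv f z))\<^sup>2)"
proof -
  let ?H = upper_half_plane
  note H = open_upper_half_plane
  have hol: "f holomorphic_on ?H"
    and int: "set_integrable lborel ?H (\<lambda>z. (cmod (deriv f z))\<^sup>2)"
    using f by (auto simp: dirichlet_space_def intro: analytic_imp_holomorphic)
  have op: "open (\<phi> ` ?H)" using open_mapping_thm3[OF \<phi>(1) H \<phi>(2)] .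
  have int': "set_integrable lborel (\<phi> ` ?H) (\<lambda>z. (cmod (deriv f z))\<^sup>2)"
    using set_integrable_subset[OF int _ \<phi>(3)] op by simp
  have chain: "(cmod (deriv \<phi> z))\<^sup>2 * (cmod (deriv f (\<phi> z)))\<^sup>2 = (cmod (deriv (f \<circ> \<phi>) z))\<^sup>2"
    if "z \<in> ?H" for z
  proof -
    have "deriv (f \<circ> \<phi>) z = deriv f (\<phi> z) * deriv \<phi> z"
      using that \<phi>(3) H by (intro deriv_chain holomorphic_on_imp_differentiable_at[OF \<phi>(1)]
          holomorphic_on_imp_differentiable_at[OF hol]) auto
    then show ?thesis by (simp add: norm_mult power_mult_distrib)
  qed
  note cov = conformal_change_of_variables[OF H \<phi>(1,2) int']
  have "set_integrable lborel ?H (\<lambda>z. (cmod (deriv (f \<circ> \<phi>) z))\<^sup>2)"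
    using cov(1) by (simp only: chain cong: set_integrable_cong)
  moreover have "(f \<circ> \<phi>) holomorphic_on ?H"
    by (rule holomorphic_on_compose_gen[OF \<phi>(1) hol \<phi>(3)])
  ultimately show "f \<circ> \<phi> \<in> dirichlet_space"
    using H by (simp add: dirichlet_space_def analytic_on_open)
  have "(LINT z:?H|lborel. (cmod (deriv (f \<circ> \<phi>) z))\<^sup>2)
      = (LINT z:?H|lborel. (cmod (deriv \<phi> z))\<^sup>2 * (cmod (deriv f (\<phi> z)))\<^sup>2)"
    using H chain by (intro set_lebesgue_integral_cong) auto
  also have "\<dots> = (LINT w:\<phi> ` ?H|lborel. (cmod (deriv f w))\<^sup>2)" by (rule cov(2))
  also have "\<dots> \<le> (LINT z:?H|lborel. (cmod (deriv f z))\<^sup>2)"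
    using op by (intro set_integral_mono_domain int \<phi>(3)) auto
  finally show "(LINT z:?H|lborel. (cmod (deriv (f \<circ> \<phi>) z))\<^sup>2)
      \<le> (LINT z:?H|lborel. (cmod (deriv f z))\<^sup>2)" .
qed

theorem theorem4p2:
  fixes \<phi> :: "complex \<Rightarrow> complex"
  assumes "univalent_on \<phi> upper_half_plane"
    and "\<phi> ` upper_half_plane \<subseteq> upper_half_plane"
  shows "composition_operator \<phi> ` dirichlet_space \<subseteq> dirichlet_space \<and>
         bounded_operator_on_dirichlet_space (composition_operator \<phi>)"
proof -
  have \<phi>: "\<phi> holomorphic_on upper_half_plane" "inj_on \<phi> upper_half_plane"
    using assms(1) by (auto simp: univalent_on_def intro: analytic_imp_holomorphic)
  note comp = dirichlet_integral_compose[OF \<phi> assms(2)]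
  have into: "composition_operator \<phi> ` dirichlet_space \<subseteq> dirichlet_space"
    using comp(1) by (auto simp: composition_operator_def)
  have "\<phi> \<i> \<in> upper_half_plane"
    using assms(2) by (rule subsetD) (simp add: upper_half_plane_def)
  from dirichlet_point_evaluation_bounded[OF this] obtain K where
    K: "\<And>f. f \<in> dirichlet_space \<Longrightarrow> cmod (f (\<phi> \<i>)) \<le> K * dirichlet_norm f" by blast
  have bd: "dirichlet_norm (composition_operator \<phi> f) \<le> sqrt (K\<^sup>2 + 1) * dirichlet_norm f"
    if f: "f \<in> dirichlet_space" for f
  proof -
    let ?D = "\<lambda>f. LINT z:upper_half_plane|lborel. (cmod (deriv f z))\<^sup>2"
    have D0: "0 \<le> ?D f"
      unfolding set_lebesgue_integral_def by (intro integral_nonneg_AE) auto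
    then have N: "(dirichlet_norm f)\<^sup>2 = (cmod (f \<i>))\<^sup>2 + ?D f"
      by (simp add: dirichlet_norm_def)
    have N0: "0 \<le> dirichlet_norm f" using D0 by (simp add: dirichlet_norm_def)
    have "(cmod (f (\<phi> \<i>)))\<^sup>2 \<le> (K * dirichlet_norm f)\<^sup>2"
      using K[OF f] by (intro power_mono) auto
    moreover have "?D (f \<circ> \<phi>) \<le> (dirichlet_norm f)\<^sup>2"
      using comp(2)[OF f] zero_le_power2[of "cmod (f \<i>)"] unfolding N by linarith
    ultimately have "(cmod (f (\<phi> \<i>)))\<^sup>2 + ?D (f \<circ> \<phi>) \<le> (K\<^sup>2 + 1) * (dirichlet_norm f)\<^sup>2"
      by (simp add: algebra_simps power_mult_distrib)
    then have "dirichlet_norm (f \<circ> \<phi>) \<le> sqrt ((K\<^sup>2 + 1) * (dirichlet_norm f)\<^sup>2)"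
      by (simp add: dirichlet_norm_def)
    then show ?thesis
      using N0 by (simp add: composition_operator_def real_sqrt_mult)
  qed
  show ?thesis
    unfolding bounded_operator_on_dirichlet_space_def
    using into bd by (intro conjI exI[of _ "sqrt (K\<^sup>2 + 1)"]) (simp_all add: composition_operator_def)
qed

end
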